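(* Let $1\le n_0\le n$ be integers. Let $\mathcal F_{n_0,n}^{\to}$ be the set of all families $\{A_{u,v},d_v,\gamma_{u,v}\}_{u,v\in[n]}$ with $A_{u,v},\gamma_{u,v}\in\{0,1\}$ and $d_v\in\{0,1,\dots,n\}$ that satisfy the constraint system (S) with parameters $n_0,n$ given in the context, and let $$\mathcal F_{n_0,n}^S=\left\{\{A_{u,v},d^{\to}_v,\gamma^{\to}_{u,v},d^{\gets}_v,\gamma^{\gets}_{u,v}\}_{u,v\in[n]}\;\middle|\;\{A_{u,v},d^{\to}_v,\gamma^{\to}_{u,v}\}_{u,v\in[n]}\in\mathcal F_{n_0,n}^{\to},\ \{A_{v,u},d^{\gets}_v,\gamma^{\gets}_{u,v}\}_{u,v\in[n]}\in\mathcal F_{n_0,n}^{\to}\right\},$$ where in the second membership the adjacency part is the transpose of $A$, i.e. its $(u,v)$ entry is $A_{v,u}$. Let $\mathcal G_{n_0,n}^S$ be the set of all strongly connected labeled directed graphs whose number of nodes $m$ satisfies $n_0\le m\le n$ (the node set being $\{0,1,\dots,m-1\}$). Then there is a bijection between $\mathcal F_{n_0,n}^S$ and $\mathcal G_{n_0,n}^S$.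
   Context: Notation: $[n]=\{0,1,\dots,n-1\}$. Graphs are directed, without self-loops or multiple edges. A graph is strongly connected if every node can reach every other node by a directed path. The variable $A_{v,v}$ encodes whether node $v$ exists, and $A_{u,v}$ ($u\ne v$) whether the edge $u\to v$ exists. Constraint system (S) with parameters $n_0,n$: 1. $\sum_{v\in[n]}A_{v,v}\ge n_0$, and $A_{v,v}\ge A_{v+1,v+1}$ for all $v\in[n-1]$; 2. $2A_{u,v}\le A_{u,u}+A_{v,v}$ and $A_{u,v}\ge\gamma_{u,v}$ for all $u,v\in[n]$, $u\neq v$; 3. $\sum_{u\in[n]}\gamma_{u,0}=0$, and for all $v\in[n]\setminus\{0\}$: $\gamma_{v,v}=0$ and $A_{v,v}\le\sum_{u\in[n]}\gamma_{u,v}\le(n-1)A_{v,v}$; 4. $d_0=0$, and $1+(n-1)(1-A_{v,v})\le d_v\le n-A_{v,v}$ for all $v\in[n]\setminus\{0\}$; 5. $(1-\gamma_{u,v})-n(1-A_{u,v})\le d_u+1-d_v\le(n+1)(1-\gamma_{u,v})$ for all $u,v\in[n]$, $u\neq v$. *)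

theory Defs
  imports "HOL-Library.FuncSet" "Graph_Theory.Digraph_Component"
begin

text \<open>
  The values of the variables are integers, so that the subtractions below are not truncated.
\<close>

definition constraints ::
  "nat \<Rightarrow> nat \<Rightarrow> (nat \<Rightarrow> nat \<Rightarrow> int) \<Rightarrow> (nat \<Rightarrow> int) \<Rightarrow> (nat \<Rightarrow> nat \<Rightarrow> int) \<Rightarrow> bool"
where
  "constraints n0 n A d \<gamma> \<longleftrightarrow>
     (\<Sum>v<n. A v v) \<ge> int n0 \<and>
     (\<forall>v<n - 1. A v v \<ge> A (v + 1) (v + 1)) \<and>
     (\<forall>u<n. \<forall>v<n. u \<noteq> v \<longrightarrow> 2 * A u v \<le> A u u + A v v \<and> A u v \<ge> \<gamma> u v) \<and>
     (\<Sum>u<n. \<gamma> u 0) = 0 \<and>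
     (\<forall>v\<in>{..<n} - {0}. \<gamma> v v = 0 \<and>
        A v v \<le> (\<Sum>u<n. \<gamma> u v) \<and> (\<Sum>u<n. \<gamma> u v) \<le> (int n - 1) * A v v) \<and>
     d 0 = 0 \<and>
     (\<forall>v\<in>{..<n} - {0}. 1 + (int n - 1) * (1 - A v v) \<le> d v \<and> d v \<le> int n - A v v) \<and>
     (\<forall>u<n. \<forall>v<n. u \<noteq> v \<longrightarrow>
        (1 - \<gamma> u v) - int n * (1 - A u v) \<le> d u + 1 - d v \<and>
        d u + 1 - d v \<le> (int n + 1) * (1 - \<gamma> u v))"

text \<open>
  Families indexed by \<open>{..<n}\<close> are extensional functions (\<open>undefined\<close> outside the index
  set), so that distinct elements of the sets below are distinct families.
\<close>

definition F_out ::
  "nat \<Rightarrow> nat \<Rightarrow> ((nat \<Rightarrow> nat \<Rightarrow> int) \<times> (nat \<Rightarrow> int) \<times> (nat \<Rightarrow> nat \<Rightarrow> int)) set"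
where
  "F_out n0 n = {(A, d, \<gamma>).
     A \<in> {..<n} \<rightarrow>\<^sub>E {..<n} \<rightarrow>\<^sub>E {0, 1} \<and>
     d \<in> {..<n} \<rightarrow>\<^sub>E {0..int n} \<and>
     \<gamma> \<in> {..<n} \<rightarrow>\<^sub>E {..<n} \<rightarrow>\<^sub>E {0, 1} \<and>
     constraints n0 n A d \<gamma>}"

definition transp_family :: "nat \<Rightarrow> (nat \<Rightarrow> nat \<Rightarrow> int) \<Rightarrow> nat \<Rightarrow> nat \<Rightarrow> int" where
  "transp_family n A = (\<lambda>u\<in>{..<n}. \<lambda>v\<in>{..<n}. A v u)"

definition F_strong ::
  "nat \<Rightarrow> nat \<Rightarrow> ((nat \<Rightarrow> nat \<Rightarrow> int) \<times> (nat \<Rightarrow> int) \<times> (nat \<Rightarrow> nat \<Rightarrow> int)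
      \<times> (nat \<Rightarrow> int) \<times> (nat \<Rightarrow> nat \<Rightarrow> int)) set"
where
  "F_strong n0 n = {(A, d_out, \<gamma>_out, d_in, \<gamma>_in).
     (A, d_out, \<gamma>_out) \<in> F_out n0 n \<and>
     (transp_family n A, d_in, \<gamma>_in) \<in> F_out n0 n}"

definition G_strong :: "nat \<Rightarrow> nat \<Rightarrow> nat pair_pre_digraph set" where
  "G_strong n0 n = {G. pair_digraph G \<and> strongly_connected (with_proj G) \<and>
     (\<exists>m. n0 \<le> m \<and> m \<le> n \<and> pverts G = {..<m})}"

end

theory Submission
  imports Defs
begin

text \<open>
  A family satisfying the constraints consists of a digraph together with auxiliary variables
  that the digraph determines. Monotonicity of the diagonal makes the existing nodes an initial
  segment \<open>{..<m}\<close>. For an existing arc \<open>u \<rightarrow> v\<close> the last constraint says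
  \<open>d v \<le> d u\<close> if \<open>\<gamma> u v = 0\<close> and \<open>d v = d u + 1\<close> if
  \<open>\<gamma> u v = 1\<close>. So \<open>d\<close> grows by at most one along an arc, and \<open>\<gamma>\<close> marks
  exactly the arcs along which it grows. Every existing node other than \<open>0\<close> must have a marked
  incoming arc, and following such arcs backwards decreases \<open>d\<close> until node \<open>0\<close> is met.
  Hence every existing node is reachable from \<open>0\<close> and \<open>d\<close> is its distance from \<open>0\<close>
  (\<open>layering_is_depth\<close>). Conversely, if all \<open>m\<close> nodes are reachable from \<open>0\<close>, the
  distances are at most \<open>m - 1\<close> and satisfy the constraints. This gives the description
  \<open>F_out_iff\<close> of the one-sided system by digraphs in which \<open>0\<close> reaches every node.

  The same description for the transposed adjacency family concerns the converse arc relation, so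
  the two-sided system describes the digraphs in which \<open>0\<close> reaches every node and every
  node reaches \<open>0\<close>, which are the strongly connected ones. Both sets in the theorem are
  therefore injective images of one set of pairs \<open>(m, E)\<close> of a node number and an arc relation.
\<close>

section \<open>Distance from a root\<close>

definition depth :: "'a rel \<Rightarrow> 'a \<Rightarrow> 'a \<Rightarrow> nat" where
  "depth E r v = (LEAST k. (r, v) \<in> E ^^ k)"

lemma relpow_depth: "(r, v) \<in> E\<^sup>* \<Longrightarrow> (r, v) \<in> E ^^ depth E r v"
  unfolding depth_def by (meson LeastI rtrancl_imp_relpow)

lemma depth_le: "(r, v) \<in> E ^^ k \<Longrightarrow> depth E r v \<le> k"
  unfolding depth_def by (rule Least_le)

lemma depth_root [simp]: "depth E r r = 0"
  using depth_le[of r r 0 E] by simp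

lemma depth_arc: "(r, u) \<in> E\<^sup>* \<Longrightarrow> (u, v) \<in> E \<Longrightarrow> depth E r v \<le> depth E r u + 1"
  using depth_le[of r v "Suc (depth E r u)" E] relpow_depth[of r u E] by auto

text \<open>The penultimate node of a shortest walk.\<close>

lemma depth_pred:
  assumes "(r, v) \<in> E\<^sup>*" "v \<noteq> r"
  obtains u where "(r, u) \<in> E\<^sup>*" "(u, v) \<in> E" "depth E r v = depth E r u + 1"
proof -
  obtain k where k: "depth E r v = Suc k"
    using relpow_depth[OF assms(1)] assms(2) by (cases "depth E r v") auto
  with relpow_depth[OF assms(1)] obtain u where u: "(r, u) \<in> E ^^ k" "(u, v) \<in> E"
    by auto
  have reach: "(r, u) \<in> E\<^sup>*"
    using u(1) by (rule relpow_imp_rtrancl)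
  have "depth E r v = depth E r u + 1"
    using depth_le[OF u(1)] depth_arc[OF reach u(2)] k by linarith
  with reach u(2) show thesis by (rule that)
qed

text \<open>
  A shortest walk passes through every smaller depth, so there are at least
  \<open>depth E r v + 1\<close> reachable nodes.
\<close>

lemma depth_less_card:
  assumes "finite V" "E\<^sup>* `` {r} \<subseteq> V" "(r, v) \<in> E\<^sup>*"
  shows "depth E r v < card V"
proof -
  have "{..k} \<subseteq> depth E r ` (E\<^sup>* `` {r})" if "(r, w) \<in> E\<^sup>*" "depth E r w = k" for k w
    using that
  proof (induction k arbitrary: w)
    case 0
    then show ?case by force
  next
    case (Suc k)
    then have "w \<noteq> r" by auto
    with Suc.prems(1) obtain u where u: "(r, u) \<in> E\<^sup>*" "depth E r w = depth E r u + 1"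
      by (rule depth_pred)
    with Suc have "{..k} \<subseteq> depth E r ` (E\<^sup>* `` {r})" by simp
    moreover have "Suc k \<in> depth E r ` (E\<^sup>* `` {r})"
      using Suc.prems by force
    ultimately show ?case by (simp add: atMost_Suc)
  qed
  with assms(3) have "{..depth E r v} \<subseteq> depth E r ` V"
    using assms(2) by blast
  then have "card {..depth E r v} \<le> card V"
    using assms(1) by (rule surj_card_le[rotated])
  then show ?thesis by simp
qed

text \<open>
  The growth bound gives \<open>d \<le> depth\<close> along a shortest walk. The predecessors produce, by
  induction on \<open>d\<close>, a walk of length \<open>d\<close> from the root, which gives reachability and the other
  inequality.
\<close>

lemma layering_is_depth:
  fixes d :: "'a \<Rightarrow> int"
  assumes root: "d r = 0"
    and arc: "\<And>u v. (u, v) \<in> E \<Longrightarrow> d v \<le> d u + 1"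
    and pos: "\<And>v. v \<in> V \<Longrightarrow> v \<noteq> r \<Longrightarrow> 1 \<le> d v"
    and pred: "\<And>v. v \<in> V \<Longrightarrow> v \<noteq> r \<Longrightarrow> \<exists>u\<in>V. (u, v) \<in> E \<and> d v = d u + 1"
    and v: "v \<in> V"
  shows "(r, v) \<in> E\<^sup>*" "d v = int (depth E r v)"
proof -
  have upper: "d w \<le> int k" if "(r, w) \<in> E ^^ k" for w k
    using that
  proof (induction k arbitrary: w)
    case 0
    then show ?case using root by simp
  next
    case (Suc k)
    then obtain u where "(r, u) \<in> E ^^ k" "(u, w) \<in> E" by auto
    with Suc.IH[of u] arc[of u w] show ?case by simp
  qed
  have walk: "(r, w) \<in> E ^^ k" if "w \<in> V" "nat (d w) = k" for w k
    using that
  proof (induction k arbitrary: w)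
    case 0
    then have "w = r" using pos[of w] by force
    then show ?case by simp
  next
    case (Suc k)
    then have "w \<noteq> r" using root by auto
    with Suc.prems pred[of w] obtain u where u: "u \<in> V" "(u, w) \<in> E" "d w = d u + 1"
      by blast
    with Suc.prems have "nat (d u) = k" by simp
    from Suc.IH[OF u(1) this] u(2) show ?case by auto
  qed
  have "0 \<le> d v"
    using pos[OF v] root by (cases "v = r") auto
  with walk[OF v refl] have "depth E r v \<le> d v"
    using depth_le[of r v "nat (d v)" E] by simp
  moreover show reach: "(r, v) \<in> E\<^sup>*"
    using walk[OF v refl] by (rule relpow_imp_rtrancl)
  ultimately show "d v = int (depth E r v)"
    using upper[OF relpow_depth[OF reach]] by simp
qed

section \<open>The one-sided constraint system\<close>

definition adjacency :: "nat \<Rightarrow> nat \<Rightarrow> nat rel \<Rightarrow> nat \<Rightarrow> nat \<Rightarrow> int" where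
  "adjacency n m E = (\<lambda>u\<in>{..<n}. \<lambda>v\<in>{..<n}. of_bool (if u = v then u < m else (u, v) \<in> E))"

text \<open>The constraints force the value \<open>n\<close> at the indices that are not nodes.\<close>

definition distances :: "nat \<Rightarrow> nat \<Rightarrow> nat rel \<Rightarrow> nat \<Rightarrow> int" where
  "distances n m E = (\<lambda>v\<in>{..<n}. int (if v < m then depth E 0 v else n))"

definition shortest_arcs :: "nat \<Rightarrow> nat rel \<Rightarrow> nat \<Rightarrow> nat \<Rightarrow> int" where
  "shortest_arcs n E = (\<lambda>u\<in>{..<n}. \<lambda>v\<in>{..<n}.
     of_bool ((u, v) \<in> E \<and> depth E 0 v = depth E 0 u + 1))"

definition loopfree_on :: "nat \<Rightarrow> nat rel \<Rightarrow> bool" where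
  "loopfree_on m E \<longleftrightarrow> E \<subseteq> {..<m} \<times> {..<m} - Id"

lemma loopfree_onD: "loopfree_on m E \<Longrightarrow> (u, v) \<in> E \<Longrightarrow> u < m \<and> v < m \<and> u \<noteq> v"
  by (auto simp: loopfree_on_def)

lemma loopfree_on_converse [simp]: "loopfree_on m (E\<inverse>) \<longleftrightarrow> loopfree_on m E"
  by (auto simp: loopfree_on_def)

lemma downset_nat_eq_lessThan:
  assumes "finite S" "\<And>v. Suc v \<in> S \<Longrightarrow> v \<in> S"
  shows "S = {..<card S}"
proof -
  have down: "u \<in> S" if "v \<in> S" "u \<le> v" for u v
    using that(2,1) by (induction rule: inc_induct) (auto intro: assms(2))
  have "S \<subseteq> {..<card S}"
  proof
    fix v assume "v \<in> S"
    then have "card {..v} \<le> card S"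
      using down assms(1) by (intro card_mono) auto
    then show "v \<in> {..<card S}" by simp
  qed
  then show ?thesis
    by (intro card_subset_eq) auto
qed

text \<open>
  The nodes form an initial segment because the diagonal decreases, and \<open>1 \<le> n0\<close> puts the root
  \<open>0\<close> among them. The last constraint turns \<open>d\<close> into a layering and \<open>\<gamma>\<close> into the indicator of
  the arcs between consecutive layers, so \<open>layering_is_depth\<close> applies.
\<close>

lemma F_out_imp_encoding:
  assumes n0: "1 \<le> n0" and F: "(A, d, \<gamma>) \<in> F_out n0 n"
  obtains m E where "n0 \<le> m" "m \<le> n" "loopfree_on m E" "\<forall>v<m. (0, v) \<in> E\<^sup>*"
    "A = adjacency n m E" "d = distances n m E" "\<gamma> = shortest_arcs n E"
proof -
  have A: "A \<in> {..<n} \<rightarrow>\<^sub>E {..<n} \<rightarrow>\<^sub>E {0, 1}" and d: "d \<in> {..<n} \<rightarrow>\<^sub>E {0..int n}"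
    and \<gamma>: "\<gamma> \<in> {..<n} \<rightarrow>\<^sub>E {..<n} \<rightarrow>\<^sub>E {0, 1}" and C: "constraints n0 n A d \<gamma>"
    using F by (auto simp: F_out_def)
  have A01: "A u v \<in> {0, 1}" and \<gamma>01: "\<gamma> u v \<in> {0, 1}" if "u < n" "v < n" for u v
    using A \<gamma> that by (meson PiE_mem lessThan_iff)+
  have card: "int n0 \<le> (\<Sum>v<n. A v v)"
    and mono: "\<And>v. v < n - 1 \<Longrightarrow> A (Suc v) (Suc v) \<le> A v v"
    and ends: "\<And>u v. u < n \<Longrightarrow> v < n \<Longrightarrow> u \<noteq> v \<Longrightarrow> 2 * A u v \<le> A u u + A v v"
    and \<gamma>_le: "\<And>u v. u < n \<Longrightarrow> v < n \<Longrightarrow> u \<noteq> v \<Longrightarrow> \<gamma> u v \<le> A u v"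
    and \<gamma>_root: "(\<Sum>u<n. \<gamma> u 0) = 0"
    and \<gamma>_diag: "\<And>v. v < n \<Longrightarrow> v \<noteq> 0 \<Longrightarrow> \<gamma> v v = 0"
    and \<gamma>_pred: "\<And>v. v < n \<Longrightarrow> v \<noteq> 0 \<Longrightarrow> A v v \<le> (\<Sum>u<n. \<gamma> u v)"
    and d0: "d 0 = 0"
    and d_ge: "\<And>v. v < n \<Longrightarrow> v \<noteq> 0 \<Longrightarrow> 1 + (int n - 1) * (1 - A v v) \<le> d v"
    and d_le: "\<And>v. v < n \<Longrightarrow> v \<noteq> 0 \<Longrightarrow> d v \<le> int n - A v v"
    and step_ge: "\<And>u v. u < n \<Longrightarrow> v < n \<Longrightarrow> u \<noteq> v \<Longrightarrow>
      (1 - \<gamma> u v) - int n * (1 - A u v) \<le> d u + 1 - d v"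
    and step_le: "\<And>u v. u < n \<Longrightarrow> v < n \<Longrightarrow> u \<noteq> v \<Longrightarrow>
      d u + 1 - d v \<le> (int n + 1) * (1 - \<gamma> u v)"
    using C by (auto simp: constraints_def)

  define S where "S = {v. v < n \<and> A v v = 1}"
  define m where "m = card S"
  define E where "E = {(u, v). u < n \<and> v < n \<and> u \<noteq> v \<and> A u v = 1}"
  have fin: "finite S" by (simp add: S_def)
  have "v \<in> S" if "Suc v \<in> S" for v
  proof -
    have v: "v < n" "v < n - 1" "A (Suc v) (Suc v) = 1" using that by (auto simp: S_def)
    then have "A v v = 1" using mono[OF v(2)] A01[of v v] by auto
    with v(1) show ?thesis by (simp add: S_def)
  qed
  with fin have S: "S = {..<m}"
    unfolding m_def by (rule downset_nat_eq_lessThan)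
  have diag: "v < m \<longleftrightarrow> v < n \<and> A v v = 1" for v
    using S by (auto simp: S_def)
  have "(\<Sum>v<n. A v v) = (\<Sum>v<n. if v \<in> S then 1 else 0)"
    using A01 by (intro sum.cong) (auto simp: S_def)
  also have "\<dots> = int (card ({..<n} \<inter> S))"
    by (simp add: sum.If_cases)
  also have "{..<n} \<inter> S = S" by (auto simp: S_def)
  finally have m_ge: "n0 \<le> m"
    using card by (simp add: m_def)
  have m_le: "m \<le> n"
    using diag[of n] by (meson less_irrefl not_le)
  have npos: "0 < n" and mpos: "0 < m"
    using n0 m_ge m_le by auto
  have E_A: "A u v = of_bool (if u = v then u < m else (u, v) \<in> E)" if "u < n" "v < n" for u v
    using that A01[of u v] diag[of u] by (auto simp: E_def)
  have E: "loopfree_on m E"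
  proof -
    have "u < m \<and> v < m \<and> u \<noteq> v" if "(u, v) \<in> E" for u v
    proof -
      have uv: "u < n" "v < n" "u \<noteq> v" "A u v = 1" using that by (auto simp: E_def)
      then have "A u u = 1 \<and> A v v = 1"
        using ends[of u v] A01[of u u] A01[of v v] by auto
      with uv show ?thesis by (simp add: diag)
    qed
    then show ?thesis by (auto simp: loopfree_on_def)
  qed

  have \<gamma>0: "\<gamma> u 0 = 0" if "u < n" for u
  proof -
    have "\<forall>u\<in>{..<n}. \<gamma> u 0 = 0"
      using \<gamma>_root npos \<gamma>01[of _ 0] by (subst (asm) sum_nonneg_eq_0_iff) force+
    with that show ?thesis by simp
  qed
  have \<gamma>_E: "\<gamma> u v = of_bool ((u, v) \<in> E \<and> d v = d u + 1)" if uv: "u < n" "v < n" for u v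
  proof (cases "u = v")
    case True
    then show ?thesis using \<gamma>0[of 0] \<gamma>_diag[of v] uv by (cases "v = 0") auto
  next
    case False
    with uv have "\<gamma> u v = 1 \<longleftrightarrow> A u v = 1 \<and> d v = d u + 1"
      using \<gamma>_le[of u v] step_ge[of u v] step_le[of u v] A01[of u v] \<gamma>01[of u v] by auto
    with False uv \<gamma>01[of u v] show ?thesis by (auto simp: E_def)
  qed
  have layering: "(0, v) \<in> E\<^sup>* \<and> d v = int (depth E 0 v)" if "v < m" for v
  proof -
    have 1: "d v \<le> d u + 1" if "(u, v) \<in> E" for u v
      using that step_ge[of u v] \<gamma>01[of u v] by (auto simp: E_def)
    have 2: "1 \<le> d v" if "v \<in> {..<m}" "v \<noteq> 0" for v
      using that d_ge[of v] diag[of v] by auto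
    have 3: "\<exists>u\<in>{..<m}. (u, v) \<in> E \<and> d v = d u + 1" if "v \<in> {..<m}" "v \<noteq> 0" for v
    proof -
      have "(\<Sum>u<n. \<gamma> u v) \<noteq> 0"
        using that \<gamma>_pred[of v] diag[of v] by auto
      then obtain u where "u < n" "\<gamma> u v \<noteq> 0"
        by (auto elim: sum.not_neutral_contains_not_neutral)
      with \<gamma>_E[of u v] m_le that have "(u, v) \<in> E \<and> d v = d u + 1"
        by (auto split: if_splits)
      with loopfree_onD[OF E] show ?thesis by blast
    qed
    show ?thesis
      using layering_is_depth[where V = "{..<m}", OF d0 1 2 3] that by blast
  qed
  have reach: "\<forall>v<m. (0, v) \<in> E\<^sup>*"
    using layering by blast
  have d_eq: "d v = int (if v < m then depth E 0 v else n)" if "v < n" for v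
  proof (cases "v < m")
    case False
    with that have "A v v = 0" "v \<noteq> 0"
      using diag[of v] A01[of v v] mpos by auto
    then show ?thesis
      using False d_ge[OF that] d_le[OF that] by simp
  qed (use layering in simp)
  have "A = adjacency n m E"
  proof (intro ext)
    fix u v
    show "A u v = adjacency n m E u v"
      using E_A[of u v] PiE_arb[OF A, of u] PiE_arb[OF PiE_mem[OF A, of u], of v]
      by (cases "u < n"; cases "v < n") (auto simp: adjacency_def)
  qed
  moreover have "d = distances n m E"
    using d_eq PiE_arb[OF d] by (intro ext) (simp add: distances_def restrict_def)
  moreover have "\<gamma> = shortest_arcs n E"
  proof (intro ext)
    fix u v
    have "d v = d u + 1 \<longleftrightarrow> depth E 0 v = depth E 0 u + 1" if "(u, v) \<in> E"
      using loopfree_onD[OF E that] layering[of u] layering[of v] by auto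
    then show "\<gamma> u v = shortest_arcs n E u v"
      using \<gamma>_E[of u v] PiE_arb[OF \<gamma>, of u] PiE_arb[OF PiE_mem[OF \<gamma>, of u], of v]
      by (cases "u < n"; cases "v < n") (auto simp: shortest_arcs_def)
  qed
  ultimately show thesis
    using that[OF m_ge m_le E reach] by blast
qed

text \<open>
  Distances from the root stay below \<open>m \<le> n\<close> and are positive away from the root, which is what
  the bounds on \<open>d\<close> ask for; the last arc of a shortest walk provides the marked incoming arc.
\<close>

lemma encoding_in_F_out:
  assumes n0: "1 \<le> n0" and m: "n0 \<le> m" "m \<le> n"
    and E: "loopfree_on m E" and reach: "\<forall>v<m. (0, v) \<in> E\<^sup>*"
  shows "(adjacency n m E, distances n m E, shortest_arcs n E) \<in> F_out n0 n"
proof -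
  let ?A = "adjacency n m E" and ?d = "distances n m E" and ?\<gamma> = "shortest_arcs n E"
  have A: "?A u v = of_bool (if u = v then u < m else (u, v) \<in> E)" if "u < n" "v < n" for u v
    using that by (simp add: adjacency_def)
  have d: "?d v = int (if v < m then depth E 0 v else n)" if "v < n" for v
    using that by (simp add: distances_def)
  have \<gamma>: "?\<gamma> u v = of_bool ((u, v) \<in> E \<and> depth E 0 v = depth E 0 u + 1)"
    if "u < n" "v < n" for u v
    using that by (simp add: shortest_arcs_def)
  have depth_less: "depth E 0 v < m" if "v < m" for v
  proof -
    have "w < m" if "(0, w) \<in> E\<^sup>*" for w
      using that n0 m by (cases rule: rtranclE) (auto dest: loopfree_onD[OF E])
    then show ?thesis
      using depth_less_card[of "{..<m}" E 0 v] reach that by auto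
  qed
  have arc: "depth E 0 v \<le> depth E 0 u + 1" if "(u, v) \<in> E" for u v
    using reach loopfree_onD[OF E that] by (intro depth_arc[OF _ that]) simp
  have depth_pos: "0 < depth E 0 v" if "v < m" "v \<noteq> 0" for v
    using depth_pred[of 0 v E] reach that by (metis add_gr_0 zero_less_one)
  have d_bounds: "0 \<le> ?d v" "?d v \<le> int n" if "v < n" for v
    using that depth_less[of v] m by (auto simp: d)

  have size: "(\<Sum>v<n. ?A v v) = int m"
  proof -
    have "(\<Sum>v<n. ?A v v) = (\<Sum>v<n. if v < m then 1 else 0)"
      by (intro sum.cong) (auto simp: A)
    also have "\<dots> = int (card ({..<n} \<inter> {..<m}))"
      by (simp add: sum.If_cases lessThan_def)
    also have "{..<n} \<inter> {..<m} = {..<m}" using m by auto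
    finally show ?thesis by simp
  qed
  have in_sum_ge: "?A v v \<le> (\<Sum>u<n. ?\<gamma> u v)" if v: "v < n" "v \<noteq> 0" for v
  proof (cases "v < m")
    case True
    with v reach obtain u where u: "(u, v) \<in> E" "depth E 0 v = depth E 0 u + 1"
      by (metis depth_pred)
    then have "u < n" using loopfree_onD[OF E u(1)] m by simp
    then have "?\<gamma> u v \<le> (\<Sum>u<n. ?\<gamma> u v)"
      using v by (intro member_le_sum) (auto simp: \<gamma>)
    with u \<open>u < n\<close> v show ?thesis by (simp add: A \<gamma>)
  next
    case False
    then show ?thesis using v by (simp add: A \<gamma> sum_nonneg)
  qed
  (* At most the n - 1 indices other than v contribute, and none if v is not a node. *)
  have in_sum_le: "(\<Sum>u<n. ?\<gamma> u v) \<le> (int n - 1) * ?A v v" if v: "v < n" for v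
  proof -
    have "(\<Sum>u<n. ?\<gamma> u v) = (\<Sum>u\<in>{..<n} - {v}. ?\<gamma> u v)"
      using v loopfree_onD[OF E, of v v] by (intro sum.mono_neutral_right) (auto simp: \<gamma>)
    also have "\<dots> \<le> (\<Sum>u\<in>{..<n} - {v}. ?A v v)"
      using v by (intro sum_mono) (auto simp: A \<gamma> dest: loopfree_onD[OF E])
    also have "\<dots> = (int n - 1) * ?A v v"
      using v by (simp add: of_nat_diff)
    finally show ?thesis .
  qed
  have root: "(\<Sum>u<n. ?\<gamma> u 0) = 0"
    using n0 m by (intro sum.neutral) (auto simp: \<gamma>)
  have step: "(1 - ?\<gamma> u v) - int n * (1 - ?A u v) \<le> ?d u + 1 - ?d v \<and>
      ?d u + 1 - ?d v \<le> (int n + 1) * (1 - ?\<gamma> u v)" if uv: "u < n" "v < n" "u \<noteq> v" for u v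
  proof (cases "(u, v) \<in> E")
    case True
    then have "?d u = depth E 0 u" "?d v = depth E 0 v" "?A u v = 1"
      using uv loopfree_onD[OF E True] by (simp_all add: d A)
    moreover have "?d u \<le> int n" using d_bounds uv by blast
    ultimately show ?thesis
      using arc[OF True] uv True by (auto simp: \<gamma>)
  next
    (* Without an arc the two inequalities only say that d u and d v differ by at most n. *)
    case False
    then show ?thesis
      using uv d_bounds[OF uv(1)] d_bounds[OF uv(2)] by (simp add: A \<gamma>)
  qed
  have "constraints n0 n ?A ?d ?\<gamma>"
    unfolding constraints_def
  proof (intro conjI allI ballI impI)
    show "int n0 \<le> (\<Sum>v<n. ?A v v)" using size m by simp
    show "?A (v + 1) (v + 1) \<le> ?A v v" if "v < n - 1" for v
      using that by (auto simp: A)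
    show "2 * ?A u v \<le> ?A u u + ?A v v" "?\<gamma> u v \<le> ?A u v" if "u < n" "v < n" "u \<noteq> v" for u v
      using that by (auto simp: A \<gamma> dest: loopfree_onD[OF E])
    show "(\<Sum>u<n. ?\<gamma> u 0) = 0" by (rule root)
    show "?\<gamma> v v = 0" if "v \<in> {..<n} - {0}" for v
      using that by (simp add: \<gamma>)
    show "?A v v \<le> (\<Sum>u<n. ?\<gamma> u v)" if "v \<in> {..<n} - {0}" for v
      using that in_sum_ge by simp
    show "(\<Sum>u<n. ?\<gamma> u v) \<le> (int n - 1) * ?A v v" if "v \<in> {..<n} - {0}" for v
      using that in_sum_le by simp
    show "?d 0 = 0" using n0 m by (simp add: d)
    show "1 + (int n - 1) * (1 - ?A v v) \<le> ?d v" "?d v \<le> int n - ?A v v"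
      if "v \<in> {..<n} - {0}" for v
      using that depth_pos[of v] depth_less[of v] m by (auto simp: A d)
  qed (use step in blast)+
  moreover have "?A \<in> {..<n} \<rightarrow>\<^sub>E {..<n} \<rightarrow>\<^sub>E {0, 1}" "?\<gamma> \<in> {..<n} \<rightarrow>\<^sub>E {..<n} \<rightarrow>\<^sub>E {0, 1}"
    unfolding adjacency_def shortest_arcs_def by (intro restrict_PiE_iff[THEN iffD2] ballI; simp)+
  moreover have "?d \<in> {..<n} \<rightarrow>\<^sub>E {0..int n}"
    using d_bounds unfolding distances_def by (auto intro!: restrict_PiE_iff[THEN iffD2])
  ultimately show ?thesis by (simp add: F_out_def)
qed

lemma F_out_iff:
  assumes "1 \<le> n0"
  shows "(A, d, \<gamma>) \<in> F_out n0 n \<longleftrightarrow>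
    (\<exists>m E. n0 \<le> m \<and> m \<le> n \<and> loopfree_on m E \<and> (\<forall>v<m. (0, v) \<in> E\<^sup>*) \<and>
       A = adjacency n m E \<and> d = distances n m E \<and> \<gamma> = shortest_arcs n E)"
  using F_out_imp_encoding[OF assms] encoding_in_F_out[OF assms] by metis

section \<open>Both orientations together\<close>

lemma adjacency_inject:
  assumes "m \<le> n" "m' \<le> n" "loopfree_on m E" "loopfree_on m' E'"
    and eq: "adjacency n m E = adjacency n m' E'"
  shows "m = m' \<and> E = E'"
proof
  have adj: "(if u = v then u < m else (u, v) \<in> E) \<longleftrightarrow> (if u = v then u < m' else (u, v) \<in> E')"
    if "u < n" "v < n" for u v
    using fun_cong[OF fun_cong[OF eq], of u v] that
    by (simp only: adjacency_def restrict_apply lessThan_iff if_True of_bool_eq_iff)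
  have "v < m \<longleftrightarrow> v < m'" for v
    using adj[of v v] assms(1,2) by (cases "v < n") auto
  then show "m = m'"
    by (meson less_irrefl linorder_neqE_nat)
  have "(u, v) \<in> E \<longleftrightarrow> (u, v) \<in> E'" for u v
    using adj[of u v] assms loopfree_onD[of m E u v] loopfree_onD[of m' E' u v]
    by (cases "u < n \<and> v < n \<and> u \<noteq> v") auto
  then show "E = E'" by auto
qed

lemma transp_adjacency: "transp_family n (adjacency n m E) = adjacency n m (E\<inverse>)"
  by (auto simp: transp_family_def adjacency_def fun_eq_iff restrict_def)

definition strong_arcs :: "nat \<Rightarrow> nat \<Rightarrow> (nat \<times> nat rel) set" where
  "strong_arcs n0 n = {(m, E). n0 \<le> m \<and> m \<le> n \<and> loopfree_on m E \<and>
     (\<forall>u<m. \<forall>v<m. (u, v) \<in> E\<^sup>*)}"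

text \<open>
  The two halves of a family share the adjacency variables, so by \<open>adjacency_inject\<close> the digraph
  read off from the transposed half is the converse of the other one. Walks through node \<open>0\<close> then
  connect any two nodes.
\<close>

lemma F_strong_eq_image:
  assumes "1 \<le> n0"
  shows "F_strong n0 n = (\<lambda>(m, E). (adjacency n m E, distances n m E, shortest_arcs n E,
    distances n m (E\<inverse>), shortest_arcs n (E\<inverse>))) ` strong_arcs n0 n" (is "_ = ?f ` _")
proof (intro subset_antisym subsetI)
  fix x assume "x \<in> F_strong n0 n"
  then obtain A d \<gamma> d' \<gamma>' where x: "x = (A, d, \<gamma>, d', \<gamma>')"
    and outward: "(A, d, \<gamma>) \<in> F_out n0 n" and inward: "(transp_family n A, d', \<gamma>') \<in> F_out n0 n"
    by (auto simp: F_strong_def)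
  from assms outward obtain m E where mE: "n0 \<le> m" "m \<le> n" "loopfree_on m E" "\<forall>v<m. (0, v) \<in> E\<^sup>*"
    "A = adjacency n m E" "d = distances n m E" "\<gamma> = shortest_arcs n E"
    by (rule F_out_imp_encoding)
  from assms inward obtain m' E' where mE': "n0 \<le> m'" "m' \<le> n" "loopfree_on m' E'"
    "\<forall>v<m'. (0, v) \<in> E'\<^sup>*" "transp_family n A = adjacency n m' E'"
    "d' = distances n m' E'" "\<gamma>' = shortest_arcs n E'"
    by (rule F_out_imp_encoding)
  have "m = m' \<and> E\<inverse> = E'"
    using mE mE' by (intro adjacency_inject[of _ n]) (simp_all add: transp_adjacency)
  then have E': "m' = m" "E' = E\<inverse>" by auto
  have "(u, v) \<in> E\<^sup>*" if "u < m" "v < m" for u v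
  proof -
    have "(u, 0) \<in> E\<^sup>*" "(0, v) \<in> E\<^sup>*"
      using that mE(4) mE'(4) by (auto simp: E' rtrancl_converse)
    then show ?thesis by (rule rtrancl_trans)
  qed
  then have "(m, E) \<in> strong_arcs n0 n"
    using mE by (simp add: strong_arcs_def)
  moreover have "x = ?f (m, E)"
    using x mE mE' E' by simp
  ultimately show "x \<in> ?f ` strong_arcs n0 n" by blast
next
  fix x assume "x \<in> ?f ` strong_arcs n0 n"
  then obtain m E where x: "x = ?f (m, E)" and mE: "n0 \<le> m" "m \<le> n" "loopfree_on m E"
    and strong: "\<And>u v. u < m \<Longrightarrow> v < m \<Longrightarrow> (u, v) \<in> E\<^sup>*"
    by (auto simp: strong_arcs_def)
  have "\<forall>v<m. (0, v) \<in> E\<^sup>*" "\<forall>v<m. (0, v) \<in> (E\<inverse>)\<^sup>*"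
    using strong mE assms by (auto simp: rtrancl_converse)
  then show "x \<in> F_strong n0 n"
    using encoding_in_F_out[OF assms mE] encoding_in_F_out[OF assms mE(1,2), of "E\<inverse>"] mE(3)
    by (simp add: x F_strong_def transp_adjacency)
qed

lemma strongly_connected_iff_rtrancl:
  assumes "pair_digraph G"
  shows "strongly_connected (with_proj G) \<longleftrightarrow>
    pverts G \<noteq> {} \<and> (\<forall>u\<in>pverts G. \<forall>v\<in>pverts G. (u, v) \<in> (parcs G)\<^sup>*)"
proof -
  interpret pair_digraph G by fact
  have "reachable (with_proj G) u v \<longleftrightarrow> u \<in> pverts G \<and> v \<in> pverts G \<and> (u, v) \<in> (parcs G)\<^sup>*" for u v
    using reachable_conv[of u v] by auto
  then show ?thesis by (auto simp: strongly_connected_def)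
qed

lemma G_strong_eq_image:
  assumes "1 \<le> n0"
  shows "G_strong n0 n = (\<lambda>(m, E). \<lparr>pverts = {..<m}, parcs = E\<rparr>) ` strong_arcs n0 n"
    (is "_ = ?g ` _")
proof (intro subset_antisym subsetI)
  fix G assume "G \<in> G_strong n0 n"
  then obtain m where G: "pair_digraph G" "strongly_connected (with_proj G)"
    and m: "n0 \<le> m" "m \<le> n" "pverts G = {..<m}"
    by (auto simp: G_strong_def)
  interpret pair_digraph G by fact
  have "loopfree_on m (parcs G)"
    using m(3) arc_fst_in_verts arc_snd_in_verts pair_no_loops
    by (fastforce simp: loopfree_on_def)
  then have "(m, parcs G) \<in> strong_arcs n0 n"
    using G m by (simp add: strong_arcs_def strongly_connected_iff_rtrancl)
  moreover have "G = ?g (m, parcs G)"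
    using m(3) by simp
  ultimately show "G \<in> ?g ` strong_arcs n0 n" by blast
next
  fix G assume "G \<in> ?g ` strong_arcs n0 n"
  then obtain m E where G: "G = \<lparr>pverts = {..<m}, parcs = E\<rparr>" and mE: "n0 \<le> m" "m \<le> n"
    "loopfree_on m E" "\<forall>u<m. \<forall>v<m. (u, v) \<in> E\<^sup>*"
    by (auto simp: strong_arcs_def)
  have "finite E"
    using mE(3) unfolding loopfree_on_def by (rule finite_subset) simp
  then have "pair_digraph G"
    using loopfree_onD[OF mE(3)] by unfold_locales (auto simp: G)
  then show "G \<in> G_strong n0 n"
    using mE assms by (auto simp: G_strong_def strongly_connected_iff_rtrancl G lessThan_empty_iff)
qed

theorem lemma2:
  fixes n0 n :: nat
  assumes "1 \<le> n0" and "n0 \<le> n"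
  shows "\<exists>f. bij_betw f (F_strong n0 n) (G_strong n0 n)"
proof -
  let ?f = "\<lambda>(m, E). (adjacency n m E, distances n m E, shortest_arcs n E,
    distances n m (E\<inverse>), shortest_arcs n (E\<inverse>))"
  let ?g = "\<lambda>(m, E). \<lparr>pverts = {..<m}, parcs = E\<rparr> :: nat pair_pre_digraph"
  have "inj_on ?f (strong_arcs n0 n)"
    by (rule inj_onI) (auto simp: strong_arcs_def dest: adjacency_inject[rotated 4])
  then have f: "bij_betw ?f (strong_arcs n0 n) (F_strong n0 n)"
    unfolding F_strong_eq_image[OF assms(1)] by (rule inj_on_imp_bij_betw)
  have "inj_on ?g (strong_arcs n0 n)"
    by (rule inj_onI) auto
  then have g: "bij_betw ?g (strong_arcs n0 n) (G_strong n0 n)"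
    unfolding G_strong_eq_image[OF assms(1)] by (rule inj_on_imp_bij_betw)
  show ?thesis
    using bij_betw_trans[OF bij_betw_inv_into[OF f] g] by blast
qed

end
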